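(* Let $V$ be a real vector space of dimension $4n$, $n>1$, with inner product $\langle\cdot,\cdot\rangle$ and three-dimensional subspace $\mathcal G\subset\mathrm{End}\,V$ as in the context. For $a\in V^*\otimes\Lambda^4V^*$ the following conditions are equivalent: 1) $a\in V^*\otimes\Lambda_0^2E\,S^2H$. 2) There exist an adapted basis $I,J,K$ of $\mathcal G$ and a unique triplet $c_I,c_J,c_K\in V^*\otimes\Lambda^2V^*$ associated with this basis, satisfying $a=\sum_{A=I,J,K}c_A\wedge\omega_A$ and the conditions: (i) $A_{(2)}A_{(3)}c_A=-c_A$ for $A=I,J,K$; (ii) $I_{(2)}J_{(3)}c_K+J_{(2)}K_{(3)}c_I+K_{(2)}I_{(3)}c_J=0$; (iii) $\langle x\lrcorner c_A,\omega_B\rangle=0$ for all $x\in V$ and $A,B=I,J,K$. 3) There exist an adapted basis $I,J,K$ of $\mathcal G$ and three tensors $d_I,d_J,d_K\in V^*\otimes\Lambda^2V^*$ satisfying $a=\sum_{A=I,J,K}d_A\wedge\omega_A$ and the conditions: (i)$'$ $A_{(2)}A_{(3)}d_A=-d_A$ for $A=I,J,K$; (ii)$'$ $I_{(2)}J_{(3)}d_K+J_{(2)}K_{(3)}d_I+K_{(2)}I_{(3)}d_J=0$.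
   Context: $\mathcal G$ admits bases $I,J,K$ (adapted bases) with $I^2=J^2=-1$, $K=IJ=-JI$, $\langle Ax,Ay\rangle=\langle x,y\rangle$ for $A=I,J,K$. Put $\omega_A(x,y)=\langle x,Ay\rangle$ and $\Omega=\sum_{A=I,J,K}\omega_A\wedge\omega_A$; $Sp(n)Sp(1)\subset SO(4n)$ is the stabilizer of $\Omega$. For a $(0,s)$-tensor $b$, $A_{(i)}b(x_1,\dots,x_s)=-b(x_1,\dots,Ax_i,\dots,x_s)$. For $c\in V^*\otimes\Lambda^2V^*$, $x\lrcorner c=c(x,\cdot,\cdot)$, and $c\wedge\omega_A\in V^*\otimes\Lambda^4V^*$ is defined by $x\lrcorner(c\wedge\omega_A)=(x\lrcorner c)\wedge\omega_A$. On two-forms, $\langle\alpha,\beta\rangle=\frac12\sum\alpha(e_i,e_j)\beta(e_i,e_j)$ ($\{e_i\}$ orthonormal). $E\cong\mathbb C^{2n}$, $H\cong\mathbb C^2$ are the fundamental representations of $Sp(n)$, $Sp(1)$ ($V\otimes\mathbb C\cong E\otimes H$), and $\Lambda_0^2E$ is the $Sp(n)$-invariant complement of $\mathbb C\omega_E$ in $\Lambda^2E$. One has $\Lambda^2V^*=S^2E+S^2H+\Lambda_0^2E\,S^2H$ with $S^2E\cong\mathfrak{sp}(n)$, $S^2H\cong\mathfrak{sp}(1)$, so $\Lambda_0^2E\,S^2H\cong(\mathfrak{sp}(n)\oplus\mathfrak{sp}(1))^\perp$ (real modules). This irreducible module occurs exactly once in $\Lambda^4V^*$; in the statement $V^*\otimes\Lambda_0^2E\,S^2H$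 is regarded as a subspace of $V^*\otimes\Lambda^4V^*$ through this copy. Equivalently it is the image, under $c\mapsto\frac14\sum_{A=I,J,K}i_A(\cdot\lrcorner c)\wedge\omega_A$ (where $i_A\alpha=(A_{(1)}+A_{(2)})\alpha$ for two-forms), of the space of $c\in V^*\otimes\Lambda^2V^*$ with $c+\sum_{A}A_{(2)}A_{(3)}c=0$ and $\langle x\lrcorner c,\omega_A\rangle=0$ for all $x\in V$, $A=I,J,K$. *)

theory Defs
  imports "HOL-Analysis.Analysis" "HOL-Library.Function_Algebras"
begin

text \<open>
  The inner product space V is a type of class \<^class>\<open>euclidean_space\<close>. Covariant tensors on V are
  curried real functions. They are added and negated pointwise (\<^theory>\<open>HOL-Library.Function_Algebras\<close>).
\<close>

definition adapted_basis ::
  "('a::euclidean_space \<Rightarrow>\<^sub>L 'a) set \<Rightarrow> ('a \<Rightarrow>\<^sub>L 'a) \<Rightarrow> ('a \<Rightarrow>\<^sub>L 'a) \<Rightarrow> ('a \<Rightarrow>\<^sub>L 'a) \<Rightarrow> bool"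
  where "adapted_basis G I J K \<longleftrightarrow>
    distinct [I, J, K] \<and> independent {I, J, K} \<and> span {I, J, K} = G \<and>
    I o\<^sub>L I = - id_blinfun \<and> J o\<^sub>L J = - id_blinfun \<and>
    K = I o\<^sub>L J \<and> K = - (J o\<^sub>L I) \<and>
    (\<forall>A\<in>{I, J, K}. \<forall>x y. A x \<bullet> A y = x \<bullet> y)"

definition omega :: "('a::euclidean_space \<Rightarrow>\<^sub>L 'a) \<Rightarrow> 'a \<Rightarrow> 'a \<Rightarrow> real"
  where "omega A x y = x \<bullet> A y"

text \<open>
  The operators \<open>A\<^bsub>(1)\<^esub>\<close>, \<open>A\<^bsub>(2)\<^esub>\<close>, \<open>A\<^bsub>(3)\<^esub>\<close>. The codomain \<^typ>\<open>'b\<close> stands for the remaining arguments,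
  so each operator applies to tensors of every sufficiently high order.
\<close>

definition slot1 :: "('a::euclidean_space \<Rightarrow>\<^sub>L 'a) \<Rightarrow> ('a \<Rightarrow> 'b::uminus) \<Rightarrow> 'a \<Rightarrow> 'b"
  where "slot1 A b = (\<lambda>x. - b (A x))"

definition slot2 :: "('a::euclidean_space \<Rightarrow>\<^sub>L 'a) \<Rightarrow> ('a \<Rightarrow> 'a \<Rightarrow> 'b::uminus) \<Rightarrow> 'a \<Rightarrow> 'a \<Rightarrow> 'b"
  where "slot2 A b = (\<lambda>x y. - b x (A y))"

definition slot3 ::
  "('a::euclidean_space \<Rightarrow>\<^sub>L 'a) \<Rightarrow> ('a \<Rightarrow> 'a \<Rightarrow> 'a \<Rightarrow> 'b::uminus) \<Rightarrow> 'a \<Rightarrow> 'a \<Rightarrow> 'a \<Rightarrow> 'b"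
  where "slot3 A b = (\<lambda>x y z. - b x y (A z))"

definition two_forms :: "('a::euclidean_space \<Rightarrow> 'a \<Rightarrow> real) set"
  where "two_forms = {\<alpha>. bilinear \<alpha> \<and> (\<forall>x. \<alpha> x x = 0)}"

text \<open>Vanishing on equal adjacent arguments makes a multilinear form alternating.\<close>

definition four_forms :: "('a::euclidean_space \<Rightarrow> 'a \<Rightarrow> 'a \<Rightarrow> 'a \<Rightarrow> real) set"
  where "four_forms = {\<beta>.
    (\<forall>y z w. linear (\<lambda>x. \<beta> x y z w)) \<and> (\<forall>x z w. linear (\<lambda>y. \<beta> x y z w)) \<and>
    (\<forall>x y w. linear (\<lambda>z. \<beta> x y z w)) \<and> (\<forall>x y z. linear (\<lambda>w. \<beta> x y z w)) \<and>
    (\<forall>x z w. \<beta> x x z w = 0) \<and> (\<forall>x y w. \<beta> x y y w = 0) \<and> (\<forall>x y z. \<beta> x y z z = 0)}"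

text \<open>
  For a finite-dimensional space U of forms, the tensor product of the dual of V with U consists of
  the linear maps from V to U, i.e. of the tensors c, linear in the first argument, with c x in U.
\<close>

definition V_two_forms :: "('a::euclidean_space \<Rightarrow> 'a \<Rightarrow> 'a \<Rightarrow> real) set"
  where "V_two_forms = {c. (\<forall>y z. linear (\<lambda>x. c x y z)) \<and> (\<forall>x. c x \<in> two_forms)}"

definition V_four_forms :: "('a::euclidean_space \<Rightarrow> 'a \<Rightarrow> 'a \<Rightarrow> 'a \<Rightarrow> 'a \<Rightarrow> real) set"
  where "V_four_forms =
    {a. (\<forall>y z w v. linear (\<lambda>x. a x y z w v)) \<and> (\<forall>x. a x \<in> four_forms)}"

text \<open>
  The wedge product is the shuffle sum, without a factor depending on the degrees. For the statement
  only its value up to a nonzero constant matters.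
\<close>

definition wedge :: "('a \<Rightarrow> 'a \<Rightarrow> real) \<Rightarrow> ('a \<Rightarrow> 'a \<Rightarrow> real) \<Rightarrow> 'a \<Rightarrow> 'a \<Rightarrow> 'a \<Rightarrow> 'a \<Rightarrow> real"
  where "wedge \<alpha> \<beta> x y z w =
      \<alpha> x y * \<beta> z w - \<alpha> x z * \<beta> y w + \<alpha> x w * \<beta> y z
    + \<alpha> y z * \<beta> x w - \<alpha> y w * \<beta> x z + \<alpha> z w * \<beta> x y"

definition wedge_snd ::
  "('a \<Rightarrow> 'a \<Rightarrow> 'a \<Rightarrow> real) \<Rightarrow> ('a \<Rightarrow> 'a \<Rightarrow> real) \<Rightarrow> 'a \<Rightarrow> 'a \<Rightarrow> 'a \<Rightarrow> 'a \<Rightarrow> 'a \<Rightarrow> real"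
  where "wedge_snd c \<beta> = (\<lambda>x. wedge (c x) \<beta>)"

definition form_inner ::
  "('a::euclidean_space \<Rightarrow> 'a \<Rightarrow> real) \<Rightarrow> ('a \<Rightarrow> 'a \<Rightarrow> real) \<Rightarrow> real"
  where "form_inner \<alpha> \<beta> = (\<Sum>i\<in>Basis. \<Sum>j\<in>Basis. \<alpha> i j * \<beta> i j) / 2"

text \<open>
  The Lie algebras of \<open>Sp(n)\<close> and \<open>Sp(1)\<close>, with skew endomorphisms identified with two-forms by
  \<^const>\<open>omega\<close>. They are the modules \<open>S\<^sup>2E\<close> and \<open>S\<^sup>2H\<close> in the space of two-forms.
\<close>

definition sp_n :: "('a::euclidean_space \<Rightarrow>\<^sub>L 'a) set \<Rightarrow> ('a \<Rightarrow> 'a \<Rightarrow> real) set"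
  where "sp_n G =
    omega ` {X. (\<forall>x y. blinfun_apply X x \<bullet> y = - (x \<bullet> blinfun_apply X y)) \<and>
      (\<forall>A\<in>G. X o\<^sub>L A = A o\<^sub>L X)}"

definition sp_1 :: "('a::euclidean_space \<Rightarrow>\<^sub>L 'a) set \<Rightarrow> ('a \<Rightarrow> 'a \<Rightarrow> real) set"
  where "sp_1 G = omega ` G"

text \<open>\<open>\<Lambda>\<^sub>0\<^sup>2E S\<^sup>2H\<close> as a space of two-forms: the orthogonal complement of the two Lie algebras.\<close>

definition L02E_S2H :: "('a::euclidean_space \<Rightarrow>\<^sub>L 'a) set \<Rightarrow> ('a \<Rightarrow> 'a \<Rightarrow> real) set"
  where "L02E_S2H G =
    {\<alpha>\<in>two_forms. \<forall>\<beta>\<in>sp_n G \<union> sp_1 G. form_inner \<alpha> \<beta> = 0}"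

text \<open>The equations that define this space: \<open>\<alpha> + \<Sum>A\<^bsub>(1)\<^esub>A\<^bsub>(2)\<^esub>\<alpha> = 0\<close> and orthogonality to the three \<open>\<omega>\<^sub>A\<close>.\<close>

lemma adapted_basisD:
  assumes "adapted_basis G I J K" "A \<in> {I, J, K}"
  shows "A (A x) = - x" "A x \<bullet> A y = x \<bullet> y" "A x \<bullet> y = - (x \<bullet> A y)"
proof -
  have ii: "I (I x) = - x" and jj: "J (J x) = - x" for x
    using assms(1) unfolding adapted_basis_def
    by (metis blinfun_apply_blinfun_compose blinfun.minus_left id_blinfun.rep_eq)+
  have k1: "K x = I (J x)" for x
    using assms(1) unfolding adapted_basis_def by (metis blinfun_apply_blinfun_compose)
  have k2: "K x = - J (I x)" for x
    using assms(1) unfolding adapted_basis_def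
    by (metis blinfun_apply_blinfun_compose blinfun.minus_left)
  have kk: "K (K x) = - x" for x
    using k1[of "K x"] k2[of x] by (simp add: blinfun.minus_right ii jj)
  show 1: "A (A x) = - x" for x using assms(2) ii jj kk by auto
  show 2: "A x \<bullet> A y = x \<bullet> y" for x y
    using assms unfolding adapted_basis_def by blast
  show "A x \<bullet> y = - (x \<bullet> A y)"
    using 2[of "A x" y] by (simp add: 1)
qed

lemma adapted_basis_mult:
  assumes "adapted_basis G I J K"
  shows "I (J x) = K x" "J (I x) = - K x" "J (K x) = I x" "K (J x) = - I x"
    "K (I x) = J x" "I (K x) = - J x"
proof -
  have k1: "K x = I (J x)" for x
    using assms(1) unfolding adapted_basis_def by (metis blinfun_apply_blinfun_compose)
  have k2: "K x = - J (I x)" for x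
    using assms(1) unfolding adapted_basis_def
    by (metis blinfun_apply_blinfun_compose blinfun.minus_left)
  have sq: "I (I x) = - x" "J (J x) = - x" for x
    using adapted_basisD(1)[OF assms] by auto
  show "I (J x) = K x" by (simp add: k1)
  show "J (I x) = - K x" by (simp add: k2)
  show "J (K x) = I x" by (simp add: k2 blinfun.minus_right sq)
  show "K (J x) = - I x" by (simp add: k1 blinfun.minus_right sq)
  show "K (I x) = J x" by (simp add: k2 blinfun.minus_right sq)
  show "I (K x) = - J x" by (simp add: k1 sq)
qed

lemma sum_Basis_skew:
  fixes A :: "'a::euclidean_space \<Rightarrow>\<^sub>L 'a" and f :: "'a \<Rightarrow> 'a \<Rightarrow> real"
  assumes "bilinear f" and sk: "\<And>x y. A x \<bullet> y = - (x \<bullet> A y)"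
  shows "(\<Sum>i\<in>Basis. f (A i) i) = - (\<Sum>i\<in>Basis. f i (A i))"
proof -
  have l: "linear (\<lambda>x. f x y)" "linear (f x)" for x y
    using assms(1) by (auto simp: bilinear_def)
  have "f (A i) i = (\<Sum>k\<in>Basis. (A i \<bullet> k) * f k i)" for i
    using linear_sum[OF l(1)[of i], of "\<lambda>k. (A i \<bullet> k) *\<^sub>R k" Basis]
    by (simp add: euclidean_representation linear_cmul[OF l(1)])
  moreover have "f k (A k) = (\<Sum>i\<in>Basis. (A k \<bullet> i) * f k i)" for k
    using linear_sum[OF l(2)[of k], of "\<lambda>i. (A k \<bullet> i) *\<^sub>R i" Basis]
    by (simp add: euclidean_representation linear_cmul[OF l(2)])
  moreover have "(\<Sum>i\<in>Basis. \<Sum>k\<in>Basis. (A i \<bullet> k) * f k i) = - (\<Sum>k\<in>Basis. \<Sum>i\<in>Basis. (A k \<bullet> i) * f k i)"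
  proof (subst sum.swap)
    show "(\<Sum>k\<in>Basis. \<Sum>i\<in>Basis. (A i \<bullet> k) * f k i) = - (\<Sum>k\<in>Basis. \<Sum>i\<in>Basis. (A k \<bullet> i) * f k i)"
      unfolding sum_negf[symmetric]
    proof (intro sum.cong refl)
      fix k i
      show "(A i \<bullet> k) * f k i = - ((A k \<bullet> i) * f k i)"
        using sk[of i k] by (simp add: inner_commute)
    qed
  qed
  ultimately show ?thesis by simp
qed

lemma form_inner_skew:
  fixes A :: "'a::euclidean_space \<Rightarrow>\<^sub>L 'a"
  assumes a: "bilinear \<alpha>" and b: "bilinear \<beta>" and sk: "\<And>x y. A x \<bullet> y = - (x \<bullet> A y)"
  shows "form_inner (slot1 A (slot2 A \<alpha>)) \<beta> = form_inner \<alpha> (slot1 A (slot2 A \<beta>))"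
proof -
  note la = bilinear_ladd[OF a] bilinear_radd[OF a] bilinear_lmul[OF a] bilinear_rmul[OF a]
  note lb = bilinear_ladd[OF b] bilinear_radd[OF b] bilinear_lmul[OF b] bilinear_rmul[OF b]
  have 1: "(\<Sum>i\<in>Basis. \<alpha> (A i) (A j) * \<beta> i j) = - (\<Sum>i\<in>Basis. \<alpha> i (A j) * \<beta> (A i) j)" for j
    by (rule sum_Basis_skew[where f = "\<lambda>x y. \<alpha> x (A j) * \<beta> y j", OF _ sk])
      (auto simp: bilinear_def linear_iff la lb algebra_simps)
  have 2: "(\<Sum>j\<in>Basis. \<alpha> i (A j) * \<beta> (A i) j) = - (\<Sum>j\<in>Basis. \<alpha> i j * \<beta> (A i) (A j))" for i
    by (rule sum_Basis_skew[where f = "\<lambda>x y. \<alpha> i x * \<beta> (A i) y", OF _ sk])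
      (auto simp: bilinear_def linear_iff la lb algebra_simps)
  have "(\<Sum>i\<in>Basis. \<Sum>j\<in>Basis. \<alpha> (A i) (A j) * \<beta> i j)
      = (\<Sum>j\<in>Basis. \<Sum>i\<in>Basis. \<alpha> (A i) (A j) * \<beta> i j)" by (rule sum.swap)
  also have "\<dots> = - (\<Sum>j\<in>Basis. \<Sum>i\<in>Basis. \<alpha> i (A j) * \<beta> (A i) j)"
    by (simp add: 1 sum_negf)
  also have "\<dots> = - (\<Sum>i\<in>Basis. \<Sum>j\<in>Basis. \<alpha> i (A j) * \<beta> (A i) j)"
    by (subst sum.swap) (rule refl)
  also have "\<dots> = (\<Sum>i\<in>Basis. \<Sum>j\<in>Basis. \<alpha> i j * \<beta> (A i) (A j))"
    by (simp add: 2 sum_negf)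
  finally show ?thesis by (simp add: form_inner_def slot1_def slot2_def)
qed

lemma form_inner_add: "form_inner (\<alpha> + \<alpha>') \<beta> = form_inner \<alpha> \<beta> + form_inner \<alpha>' \<beta>"
  "form_inner \<beta> (\<alpha> + \<alpha>') = form_inner \<beta> \<alpha> + form_inner \<beta> \<alpha>'"
  by (simp_all add: form_inner_def distrib_left distrib_right sum.distrib add_divide_distrib)

lemma form_inner_self_eq_0:
  fixes \<beta> :: "'a::euclidean_space \<Rightarrow> 'a \<Rightarrow> real"
  assumes b: "bilinear \<beta>" and 0: "form_inner \<beta> \<beta> = 0"
  shows "\<beta> = 0"
proof -
  have "(\<Sum>i\<in>Basis. \<Sum>j\<in>Basis. \<beta> i j * \<beta> i j) = 0" using 0 by (simp add: form_inner_def)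
  hence z: "\<beta> i j = 0" if "i \<in> Basis" "j \<in> Basis" for i j
    using that by (simp add: sum_nonneg_eq_0_iff sum_nonneg)
  have l: "linear (\<lambda>x. \<beta> x y)" "linear (\<beta> x)" for x y
    using b by (auto simp: bilinear_def)
  have "\<beta> = (\<lambda>_ _. 0)"
    by (rule bilinear_eq_stdbasis[OF b]) (auto simp: z bilinear_def linear_iff)
  thus ?thesis by (simp add: zero_fun_def)
qed

lemma two_forms_skew:
  assumes "\<alpha> \<in> two_forms"
  shows "\<alpha> x y = - \<alpha> y x"
proof -
  have b: "bilinear \<alpha>" and z: "\<And>x. \<alpha> x x = 0" using assms by (auto simp: two_forms_def)
  have "\<alpha> (x + y) (x + y) = \<alpha> x y + \<alpha> y x"
    using z[of x] z[of y] by (simp add: bilinear_ladd[OF b] bilinear_radd[OF b])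
  with z[of "x + y"] show ?thesis by linarith
qed

lemma L02E_S2H_iff:
  fixes G :: "('a::euclidean_space \<Rightarrow>\<^sub>L 'a) set"
  assumes ab: "adapted_basis G I J K" and al: "\<alpha> \<in> two_forms"
  shows "\<alpha> \<in> L02E_S2H G \<longleftrightarrow>
    \<alpha> + (slot1 I (slot2 I \<alpha>) + slot1 J (slot2 J \<alpha>) + slot1 K (slot2 K \<alpha>)) = 0 \<and>
    (\<forall>A\<in>{I, J, K}. form_inner \<alpha> (omega A) = 0)"
proof -
  have G: "G = span {I, J, K}" using ab unfolding adapted_basis_def by blast
  have b: "bilinear \<alpha>" using al by (auto simp: two_forms_def)
  note la = bilinear_ladd[OF b] bilinear_radd[OF b] bilinear_lmul[OF b] bilinear_rmul[OF b]
    bilinear_lneg[OF b] bilinear_rneg[OF b]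
  note sk = adapted_basisD(3)[OF ab]
  note sq = adapted_basisD(1)[OF ab]
  note mu = adapted_basis_mult[OF ab]
  define \<beta> where
    "\<beta> = \<alpha> + (slot1 I (slot2 I \<alpha>) + slot1 J (slot2 J \<alpha>) + slot1 K (slot2 K \<alpha>))"
  have \<beta>: "\<beta> x y = \<alpha> x y + \<alpha> (I x) (I y) + \<alpha> (J x) (J y) + \<alpha> (K x) (K y)" for x y
    by (simp add: \<beta>_def slot1_def slot2_def)
  have bb: "bilinear \<beta>"
    by (auto simp: bilinear_def linear_iff \<beta> la blinfun.add_right blinfun.scaleR_right
        algebra_simps)
  have key: "form_inner \<beta> \<gamma> = 4 * form_inner \<alpha> \<gamma>"
    if "bilinear \<gamma>" "\<And>A x y. A \<in> {I, J, K} \<Longrightarrow> \<gamma> (A x) (A y) = \<gamma> x y" for \<gamma>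
  proof -
    have "form_inner (slot1 A (slot2 A \<alpha>)) \<gamma> = form_inner \<alpha> \<gamma>" if A: "A \<in> {I, J, K}" for A
    proof -
      have "slot1 A (slot2 A \<gamma>) = \<gamma>"
        using \<open>\<And>A x y. A \<in> {I, J, K} \<Longrightarrow> \<gamma> (A x) (A y) = \<gamma> x y\<close>[OF A]
        by (simp add: slot1_def slot2_def fun_eq_iff)
      thus ?thesis using form_inner_skew[OF b \<open>bilinear \<gamma>\<close> sk[OF A]] by simp
    qed
    thus ?thesis by (simp add: \<beta>_def form_inner_add)
  qed
  have inv: "\<beta> (A x) (A y) = \<beta> x y" if "A \<in> {I, J, K}" for A x y
    using that by (auto simp: \<beta> mu sq la)
  have s1: "(\<forall>\<gamma>\<in>sp_1 G. form_inner \<alpha> \<gamma> = 0) \<longleftrightarrow>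
    (\<forall>A\<in>{I, J, K}. form_inner \<alpha> (omega A) = 0)"
  proof -
    have "linear (\<lambda>A. form_inner \<alpha> (omega A))"
    proof (rule linearI)
      show "form_inner \<alpha> (omega (A + B)) = form_inner \<alpha> (omega A) + form_inner \<alpha> (omega B)" for A B
        by (simp add: form_inner_add(2)[symmetric] omega_def[abs_def] blinfun.add_left inner_add_right plus_fun_def)
      show "form_inner \<alpha> (omega (r *\<^sub>R A)) = r *\<^sub>R form_inner \<alpha> (omega A)" for r A
        by (simp add: form_inner_def omega_def blinfun.scaleR_left sum_distrib_left mult.left_commute)
    qed
    hence "form_inner \<alpha> (omega A) = 0"
      if "\<forall>A\<in>{I, J, K}. form_inner \<alpha> (omega A) = 0" "A \<in> G" for A
      using linear_eq_0_on_span[of "\<lambda>A. form_inner \<alpha> (omega A)" "{I, J, K}" A] that(1) that(2)[unfolded G] by blast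
    moreover have "{I, J, K} \<subseteq> G" unfolding G by (rule span_superset)
    ultimately show ?thesis unfolding sp_1_def by blast
  qed
  have s2: "(\<forall>\<gamma>\<in>sp_n G. form_inner \<alpha> \<gamma> = 0) \<longleftrightarrow> \<beta> = 0"
  proof
    assume "\<beta> = 0"
    have "form_inner \<alpha> (omega X) = 0"
      if X: "\<forall>x y. X x \<bullet> y = - (x \<bullet> X y)" "\<forall>A\<in>G. X o\<^sub>L A = A o\<^sub>L X" for X :: "'a \<Rightarrow>\<^sub>L 'a"
    proof -
      have "bilinear (omega X)"
        by (auto simp: bilinear_def linear_iff omega_def inner_add_left inner_add_right
            blinfun.add_right blinfun.scaleR_right)
      moreover have "omega X (A x) (A y) = omega X x y" if A: "A \<in> {I, J, K}" for A x y
      proof -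
        have "A \<in> G" unfolding G using A by (rule span_base)
        hence "(X o\<^sub>L A) y = (A o\<^sub>L X) y" using X(2) by simp
        hence "X (A y) = A (X y)" by simp
        thus ?thesis by (simp add: omega_def adapted_basisD(2)[OF ab A])
      qed
      ultimately have "form_inner \<beta> (omega X) = 4 * form_inner \<alpha> (omega X)" by (rule key)
      thus ?thesis using \<open>\<beta> = 0\<close> by (simp add: form_inner_def)
    qed
    thus "\<forall>\<gamma>\<in>sp_n G. form_inner \<alpha> \<gamma> = 0" by (auto simp: sp_n_def)
  next
    assume orth: "\<forall>\<gamma>\<in>sp_n G. form_inner \<alpha> \<gamma> = 0"
    have lin: "linear (\<lambda>y. \<Sum>i\<in>Basis. \<beta> i y *\<^sub>R i)"
      using bb by (auto simp: linear_iff bilinear_def scaleR_left_distrib sum.distrib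
          scaleR_sum_right)
    define X where "X = Blinfun (\<lambda>y. \<Sum>i\<in>Basis. \<beta> i y *\<^sub>R i)"
    have X: "X y = (\<Sum>i\<in>Basis. \<beta> i y *\<^sub>R i)" for y
      unfolding X_def by (subst bounded_linear_Blinfun_apply)
        (auto simp: lin linear_conv_bounded_linear[symmetric])
    have om: "x \<bullet> X y = \<beta> x y" for x y
    proof -
      have l: "linear (\<lambda>x. \<beta> x y)" using bb by (simp add: bilinear_def)
      have "\<beta> x y = (\<Sum>i\<in>Basis. (x \<bullet> i) * \<beta> i y)"
        using linear_sum[OF l, of "\<lambda>i. (x \<bullet> i) *\<^sub>R i" Basis]
        by (simp add: euclidean_representation linear_cmul[OF l])
      thus ?thesis by (simp add: X inner_sum_right mult.commute)
    qed
    have "\<beta> x y = - \<beta> y x" for x y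
      unfolding \<beta> using two_forms_skew[OF al, of x y] two_forms_skew[OF al, of "I x" "I y"]
        two_forms_skew[OF al, of "J x" "J y"] two_forms_skew[OF al, of "K x" "K y"]
      by linarith
    hence Xs: "X x \<bullet> y = - (x \<bullet> X y)" for x y
      unfolding inner_commute[of "X x" y] om by blast
    have "X o\<^sub>L A = A o\<^sub>L X" if "A \<in> {I, J, K}" for A
    proof (rule blinfun_eqI)
      fix y
      have "x \<bullet> X (A y) = x \<bullet> A (X y)" for x
      proof -
        have "x \<bullet> X (A y) = \<beta> (A x) (A (A y))" using inv[OF that, of x "A y"] by (simp add: om)
        also have "\<dots> = - (A x \<bullet> X y)"
          by (simp add: sq[OF that] bilinear_rneg[OF bb] om)
        also have "\<dots> = x \<bullet> A (X y)" by (simp add: sk[OF that])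
        finally show ?thesis .
      qed
      hence "X (A y) = A (X y)" by (metis vector_eq_ldot)
      thus "(X o\<^sub>L A) y = (A o\<^sub>L X) y" by simp
    qed
    moreover have "subspace {A. X o\<^sub>L A = A o\<^sub>L X}"
    proof -
      have "X o\<^sub>L A = A o\<^sub>L X \<longleftrightarrow> (\<forall>x. X (A x) = A (X x))" for A
        by (metis blinfun_apply_blinfun_compose blinfun_eqI)
      thus ?thesis
        by (simp add: subspace_def blinfun.add_left blinfun.scaleR_left
            blinfun.add_right blinfun.scaleR_right)
    qed
    ultimately have "G \<subseteq> {A. X o\<^sub>L A = A o\<^sub>L X}"
      unfolding G by (intro span_minimal) auto
    hence "omega X \<in> sp_n G" using Xs by (auto simp: sp_n_def)
    moreover have "omega X = \<beta>" by (simp add: omega_def om fun_eq_iff)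
    ultimately have "form_inner \<alpha> \<beta> = 0" using orth by auto
    hence "form_inner \<beta> \<beta> = 0" using key[OF bb inv] by simp
    thus "\<beta> = 0" by (rule form_inner_self_eq_0[OF bb])
  qed
  show ?thesis using al s1 s2 unfolding L02E_S2H_def \<beta>_def[symmetric] by blast
qed

definition i_op ::
  "('a::euclidean_space \<Rightarrow>\<^sub>L 'a) \<Rightarrow> ('a \<Rightarrow> 'a \<Rightarrow> real) \<Rightarrow> 'a \<Rightarrow> 'a \<Rightarrow> real"
  where "i_op A \<alpha> = slot1 A \<alpha> + slot2 A \<alpha>"

text \<open>
  The unique copy of this module in the space of four-forms is the image of the \<open>Sp(n)Sp(1)\<close>-equivariant map
  sending \<open>\<alpha>\<close> to a quarter of \<open>i\<^sub>I \<alpha> \<and> \<omega>\<^sub>I + i\<^sub>J \<alpha> \<and> \<omega>\<^sub>J + i\<^sub>K \<alpha> \<and> \<omega>\<^sub>K\<close>. The map does not depend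
  on the adapted basis.
\<close>

definition embed_four ::
  "('a::euclidean_space \<Rightarrow>\<^sub>L 'a) \<Rightarrow> ('a \<Rightarrow>\<^sub>L 'a) \<Rightarrow> ('a \<Rightarrow>\<^sub>L 'a) \<Rightarrow>
    ('a \<Rightarrow> 'a \<Rightarrow> real) \<Rightarrow> 'a \<Rightarrow> 'a \<Rightarrow> 'a \<Rightarrow> 'a \<Rightarrow> real"
  where "embed_four I J K \<alpha> = (\<lambda>x y z w. 1/4 *
    (wedge (i_op I \<alpha>) (omega I) x y z w + wedge (i_op J \<alpha>) (omega J) x y z w
      + wedge (i_op K \<alpha>) (omega K) x y z w))"

definition V_L02E_S2H ::
  "('a::euclidean_space \<Rightarrow>\<^sub>L 'a) set \<Rightarrow> ('a \<Rightarrow> 'a \<Rightarrow> 'a \<Rightarrow> 'a \<Rightarrow> 'a \<Rightarrow> real) set"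
  where "V_L02E_S2H G =
    {(\<lambda>x. embed_four I J K (c x)) | I J K c.
      adapted_basis G I J K \<and> c \<in> V_two_forms \<and> (\<forall>x. c x \<in> L02E_S2H G)}"

end

theory Submission
  imports Defs
begin

text \<open>
  The first argument of a tensor in \<open>V\<^sup>* \<otimes> \<Lambda>\<^sup>4V\<^sup>*\<close> is a mere parameter, so everything takes place in the
  algebra of two-forms and depends linearly on \<open>x\<close>.

  Fix an adapted basis. A triple of two-forms \<open>\<alpha>\<close>, \<open>\<beta>\<close>, \<open>\<gamma>\<close> is called compatible when \<open>\<alpha>\<close>, \<open>\<beta>\<close>, \<open>\<gamma>\<close> change
  sign under \<open>I\<close>, \<open>J\<close>, \<open>K\<close> respectively and the mixed relation
  \<open>\<gamma>(I\<cdot>, J\<cdot>) + \<alpha>(J\<cdot>, K\<cdot>) + \<beta>(K\<cdot>, I\<cdot>) = 0\<close> holds. To see what this means, write a two-form with no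
  \<open>Sp(n)\<close> part as \<open>\<delta>(y, z) = S\<^sub>1(y, I z) + S\<^sub>2(y, J z) + S\<^sub>3(y, K z)\<close> with symmetric \<open>G\<close>-invariant
  forms \<open>S\<^sub>1\<close>, \<open>S\<^sub>2\<close>, \<open>S\<^sub>3\<close>. The first form of a compatible triple, being anti-invariant under \<open>I\<close>, is of
  the shape \<open>U(y, J z) + W(y, K z)\<close> with such \<open>U\<close> and \<open>W\<close>, and likewise for the other two. The mixed relation
  ties the six coefficients together in pairs, so that three remain, and these are the coefficients of
  one form \<open>\<delta>\<close>. In invariant terms, compatible triples are exactly the triples of \<open>i\<^sub>A \<delta> / 4\<close>, with
  inverse \<open>\<delta>(y, z) = \<alpha>(y, I z) + \<beta>(y, J z) + \<gamma>(y, K z)\<close>. These two directions are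
  \<open>i_op_compatible_triple\<close> and \<open>i_op_triple_generator\<close>; that \<open>\<delta>\<close> is orthogonal to \<open>sp(n)\<close> is
  \<open>triple_generator_sum_eq_0\<close>.

  So a sum of \<open>c\<^sub>A \<and> \<omega>\<^sub>A\<close> over a compatible triple is \<open>embed_four\<close> applied to some \<open>\<delta>\<close> orthogonal to the
  \<open>Sp(n)\<close> part. Such a \<open>\<delta>\<close> may still have a component along the \<open>\<omega>\<^sub>A\<close>, but \<open>embed_four\<close> kills each
  \<open>\<omega>\<^sub>A\<close>: its \<open>i\<^sub>B\<close> are multiples of the other two \<open>\<omega>\<close>, and the wedge products cancel since two-forms
  commute. Subtracting the component puts \<open>\<delta>\<close> into \<open>\<Lambda>\<^sub>0\<^sup>2E S\<^sup>2H\<close> without changing the four-form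
  (\<open>compatible_triples_imp_V_L02E_S2H\<close>).

  Uniqueness of the triple orthogonal to all \<open>\<omega>\<^sub>B\<close> comes from an explicit inverse. Contracting
  \<open>\<alpha> \<and> \<omega>\<^sub>I + \<beta> \<and> \<omega>\<^sub>J + \<gamma> \<and> \<omega>\<^sub>K\<close> with \<open>I\<close> in the first two arguments gives \<open>- dim V\<close> times \<open>\<alpha>\<close>: the term
  \<open>\<alpha> \<and> \<omega>\<^sub>I\<close> gives \<open>(4 - dim V) \<alpha>\<close> and the two others together \<open>- 4 \<alpha>\<close>
  (\<open>contraction_compatible_triple\<close>). Rotating the adapted basis recovers \<open>\<beta>\<close> and \<open>\<gamma>\<close> in the same way.
\<close>

section \<open>Two-forms and adapted bases\<close>

lemma two_formsD:
  assumes "\<alpha> \<in> two_forms"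
  shows "bilinear \<alpha>" "\<alpha> (x + y) z = \<alpha> x z + \<alpha> y z" "\<alpha> x (y + z) = \<alpha> x y + \<alpha> x z"
    "\<alpha> (r *\<^sub>R x) y = r * \<alpha> x y" "\<alpha> x (r *\<^sub>R y) = r * \<alpha> x y"
    "\<alpha> (- x) y = - \<alpha> x y" "\<alpha> x (- y) = - \<alpha> x y"
proof -
  show b: "bilinear \<alpha>" using assms by (simp add: two_forms_def)
  show "\<alpha> (x + y) z = \<alpha> x z + \<alpha> y z" "\<alpha> x (y + z) = \<alpha> x y + \<alpha> x z"
    "\<alpha> (r *\<^sub>R x) y = r * \<alpha> x y" "\<alpha> x (r *\<^sub>R y) = r * \<alpha> x y"
    "\<alpha> (- x) y = - \<alpha> x y" "\<alpha> x (- y) = - \<alpha> x y"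
    by (simp_all add: bilinear_ladd[OF b] bilinear_radd[OF b] bilinear_lmul[OF b]
        bilinear_rmul[OF b] bilinear_lneg[OF b] bilinear_rneg[OF b])
qed

lemma two_formsI:
  assumes "\<And>x y z. \<alpha> (x + y) z = \<alpha> x z + \<alpha> y z" "\<And>r x y. \<alpha> (r *\<^sub>R x) y = r * \<alpha> x y"
    "\<And>x y. \<alpha> x y = - \<alpha> y x"
  shows "\<alpha> \<in> two_forms"
proof -
  have r: "\<alpha> x (y + z) = \<alpha> x y + \<alpha> x z" "\<alpha> x (r *\<^sub>R y) = r * \<alpha> x y" for x y z r
    using assms(3)[of x "y + z"] assms(3)[of x y] assms(3)[of x z] assms(3)[of x "r *\<^sub>R y"]
    by (simp_all add: assms(1,2))
  have "\<alpha> x x = 0" for x using assms(3)[of x x] by linarith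
  thus ?thesis by (simp add: two_forms_def bilinear_def linear_iff assms(1,2) r)
qed

text \<open>
  All conditions are cyclic in \<open>I\<close>, \<open>J\<close>, \<open>K\<close>. By rotating the basis, a computation made for \<open>I\<close> serves
  for \<open>J\<close> and \<open>K\<close>.
\<close>

lemma adapted_basis_rotate:
  assumes "adapted_basis G I J K"
  shows "adapted_basis G J K I"
proof -
  have K: "{J, K, I} = {I, J, K}" by auto
  have "K o\<^sub>L K = - id_blinfun" "I = J o\<^sub>L K" "I = - (K o\<^sub>L J)"
    by (rule blinfun_eqI; simp add: blinfun.minus_left adapted_basis_mult[OF assms]
        adapted_basisD(1)[OF assms])+
  with assms show ?thesis unfolding adapted_basis_def K by auto
qed

lemma omega_two_forms:
  assumes "adapted_basis G I J K" "A \<in> {I, J, K}"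
  shows "omega A \<in> two_forms"
  by (rule two_formsI)
    (auto simp: omega_def inner_add_left adapted_basisD(3)[OF assms, symmetric]
      inner_add_right inner_commute)

lemma i_op_apply: "i_op A \<alpha> x y = - \<alpha> (A x) y - \<alpha> x (A y)"
  by (simp add: i_op_def slot1_def slot2_def)

lemma i_op_two_forms:
  assumes "\<alpha> \<in> two_forms"
  shows "i_op A \<alpha> \<in> two_forms"
proof (rule two_formsI)
  show "i_op A \<alpha> x y = - i_op A \<alpha> y x" for x y
    using two_forms_skew[OF assms, of "A x" y] two_forms_skew[OF assms, of x "A y"]
    by (simp add: i_op_apply)
qed (simp_all add: i_op_apply two_formsD[OF assms] blinfun.add_right blinfun.scaleR_right
    algebra_simps)

section \<open>Compatible triples and the two-form that generates them\<close>

definition compatible_triple ::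
  "('a::euclidean_space \<Rightarrow>\<^sub>L 'a) \<Rightarrow> ('a \<Rightarrow>\<^sub>L 'a) \<Rightarrow> ('a \<Rightarrow>\<^sub>L 'a) \<Rightarrow>
    ('a \<Rightarrow> 'a \<Rightarrow> real) \<Rightarrow> ('a \<Rightarrow> 'a \<Rightarrow> real) \<Rightarrow> ('a \<Rightarrow> 'a \<Rightarrow> real) \<Rightarrow> bool"
  where "compatible_triple I J K \<alpha> \<beta> \<gamma> \<longleftrightarrow>
    \<alpha> \<in> two_forms \<and> \<beta> \<in> two_forms \<and> \<gamma> \<in> two_forms \<and>
    (\<forall>y z. \<alpha> (I y) (I z) = - \<alpha> y z) \<and> (\<forall>y z. \<beta> (J y) (J z) = - \<beta> y z) \<and>
    (\<forall>y z. \<gamma> (K y) (K z) = - \<gamma> y z) \<and>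
    (\<forall>y z. \<gamma> (I y) (J z) + \<alpha> (J y) (K z) + \<beta> (K y) (I z) = 0)"

lemma compatible_triple_rotate:
  assumes "compatible_triple I J K \<alpha> \<beta> \<gamma>"
  shows "compatible_triple J K I \<beta> \<gamma> \<alpha>"
  using assms unfolding compatible_triple_def by (auto simp: algebra_simps)

lemma anti_invariant_swap:
  assumes "adapted_basis G I J K" "A \<in> {I, J, K}" "\<alpha> \<in> two_forms"
    "\<And>y z. \<alpha> (A y) (A z) = - \<alpha> y z"
  shows "\<alpha> (A y) z = \<alpha> y (A z)"
  using assms(4)[of y "A z"]
  by (simp add: adapted_basisD(1)[OF assms(1,2)] two_formsD[OF assms(3)])

text \<open>
  The mixed relation, taken at \<open>J y\<close> and \<open>K z\<close>, expresses \<open>\<alpha>\<close> by \<open>\<beta>\<close> and \<open>\<gamma>\<close>. Antisymmetrizing in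
  \<open>y\<close> and \<open>z\<close> turns this into \<open>i\<^sub>J \<gamma> - i\<^sub>K \<beta> = 2 \<alpha>\<close>, the form used both to invert \<open>i\<^sub>I\<close> and
  to contract.
\<close>

lemma compatible_triple_first:
  assumes ab: "adapted_basis G I J K" and ct: "compatible_triple I J K \<alpha> \<beta> \<gamma>"
  shows "\<beta> (K y) z + \<beta> y (K z) - \<gamma> (J y) z - \<gamma> y (J z) = 2 * \<alpha> y z"
proof -
  note mu = adapted_basis_mult[OF ab]
  note sq = adapted_basisD(1)[OF ab]
  have fa: "\<alpha> \<in> two_forms" and fb: "\<beta> \<in> two_forms" and fc: "\<gamma> \<in> two_forms"
    and b: "\<beta> (J y) (J z) = - \<beta> y z" and c: "\<gamma> (K y) (K z) = - \<gamma> y z"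
    and m: "\<gamma> (I y) (J z) + \<alpha> (J y) (K z) + \<beta> (K y) (I z) = 0" for y z
    using ct unfolding compatible_triple_def by auto
  \<comment> \<open>Anti-invariance of \<open>\<beta>\<close> and \<open>\<gamma>\<close> brings the other two terms to the wanted arguments.\<close>
  have half: "\<alpha> y z = \<beta> (K y) z - \<gamma> y (J z)" for y z
    using m[of "J y" "K z"] b[of "I y" "J z"] c[of y "J z"]
    by (simp add: mu sq two_formsD[OF fa] two_formsD[OF fb] two_formsD[OF fc] blinfun.minus_right)
  show ?thesis
    using half[of y z] half[of z y] two_forms_skew[OF fa, of y z]
      two_forms_skew[OF fb, of "K z" y] two_forms_skew[OF fc, of z "J y"]
    by simp
qed

text \<open>
  Since \<open>I\<^sup>2 = -1\<close>, replacing both arguments by their images under \<open>I\<close> exchanges the two terms of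
  \<open>i\<^sub>I \<beta>\<close> up to sign. In the mixed relation each term is a difference of two of the forms
  \<open>\<beta>(A\<cdot>, A\<cdot>)\<close>, and the cyclic sum telescopes.
\<close>

lemma i_op_compatible_triple:
  assumes ab: "adapted_basis G I J K" and f: "\<beta> \<in> two_forms"
  shows "compatible_triple I J K (\<lambda>y z. i_op I \<beta> y z / 4) (\<lambda>y z. i_op J \<beta> y z / 4)
    (\<lambda>y z. i_op K \<beta> y z / 4)"
proof -
  have q: "(\<lambda>y z. i_op A \<beta> y z / 4) \<in> two_forms" for A
  proof (rule two_formsI)
    show "i_op A \<beta> x y / 4 = - (i_op A \<beta> y x / 4)" for x y
      using two_forms_skew[OF i_op_two_forms[OF f], of A x y] by simp
  qed (simp_all add: two_formsD[OF i_op_two_forms[OF f]] add_divide_distrib)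
  show ?thesis
    unfolding compatible_triple_def
    by (intro conjI allI q)
      (simp_all add: i_op_apply adapted_basis_mult[OF ab] adapted_basisD(1)[OF ab] two_formsD[OF f]
        field_simps)
qed

text \<open>
  For a compatible triple, \<open>i\<^sub>I \<alpha> + i\<^sub>J \<beta> + i\<^sub>K \<gamma>\<close> is \<open>- 2\<close> times this form.
\<close>

definition triple_generator ::
  "('a::euclidean_space \<Rightarrow>\<^sub>L 'a) \<Rightarrow> ('a \<Rightarrow>\<^sub>L 'a) \<Rightarrow> ('a \<Rightarrow>\<^sub>L 'a) \<Rightarrow>
    ('a \<Rightarrow> 'a \<Rightarrow> real) \<Rightarrow> ('a \<Rightarrow> 'a \<Rightarrow> real) \<Rightarrow> ('a \<Rightarrow> 'a \<Rightarrow> real) \<Rightarrow> 'a \<Rightarrow> 'a \<Rightarrow> real"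
  where "triple_generator I J K \<alpha> \<beta> \<gamma> y z = \<alpha> y (I z) + \<beta> y (J z) + \<gamma> y (K z)"

lemma triple_generator_rotate:
  "triple_generator J K I \<beta> \<gamma> \<alpha> = triple_generator I J K \<alpha> \<beta> \<gamma>"
  by (simp add: triple_generator_def fun_eq_iff)

text \<open>
  Each form of a compatible triple lets its own structure pass from one argument to the other. Together
  with the definition, this formula gives skew-symmetry of the generator.
\<close>

lemma triple_generator_left:
  assumes ab: "adapted_basis G I J K" and ct: "compatible_triple I J K \<alpha> \<beta> \<gamma>"
  shows "triple_generator I J K \<alpha> \<beta> \<gamma> y z = \<alpha> (I y) z + \<beta> (J y) z + \<gamma> (K y) z"
  using anti_invariant_swap[OF ab, of I \<alpha> y z] anti_invariant_swap[OF ab, of J \<beta> y z]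
    anti_invariant_swap[OF ab, of K \<gamma> y z] ct
  by (simp add: triple_generator_def compatible_triple_def)

lemma triple_generator_two_forms:
  assumes ab: "adapted_basis G I J K" and ct: "compatible_triple I J K \<alpha> \<beta> \<gamma>"
  shows "triple_generator I J K \<alpha> \<beta> \<gamma> \<in> two_forms"
proof -
  have f: "\<alpha> \<in> two_forms" "\<beta> \<in> two_forms" "\<gamma> \<in> two_forms"
    using ct unfolding compatible_triple_def by auto
  note l = two_formsD[OF f(1)] two_formsD[OF f(2)] two_formsD[OF f(3)]
  show ?thesis
  proof (rule two_formsI)
    show "triple_generator I J K \<alpha> \<beta> \<gamma> x y = - triple_generator I J K \<alpha> \<beta> \<gamma> y x" for x y
      using triple_generator_left[OF ab ct, of x y]
        triple_generator_def[of I J K \<alpha> \<beta> \<gamma> y x]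
        two_forms_skew[OF f(1), of "I x" y] two_forms_skew[OF f(2), of "J x" y]
        two_forms_skew[OF f(3), of "K x" y] by linarith
  qed (simp_all add: triple_generator_def l algebra_simps)
qed

text \<open>
  In \<open>i\<^sub>I\<close> of the generator, \<open>\<alpha>\<close> contributes \<open>2 \<alpha>\<close> since \<open>I\<^sup>2 = -1\<close>. The contributions of \<open>\<beta>\<close>
  and \<open>\<gamma>\<close> combine to the left-hand side of \<open>compatible_triple_first\<close>, that is to another \<open>2 \<alpha>\<close>.
\<close>

lemma i_op_triple_generator:
  assumes ab: "adapted_basis G I J K" and ct: "compatible_triple I J K \<alpha> \<beta> \<gamma>"
  shows "i_op I (triple_generator I J K \<alpha> \<beta> \<gamma>) y z = 4 * \<alpha> y z"
    "i_op J (triple_generator I J K \<alpha> \<beta> \<gamma>) y z = 4 * \<beta> y z"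
    "i_op K (triple_generator I J K \<alpha> \<beta> \<gamma>) y z = 4 * \<gamma> y z"
proof -
  have *: "i_op I (triple_generator I J K \<alpha> \<beta> \<gamma>) y z = 4 * \<alpha> y z"
    if ab: "adapted_basis G I J K" and ct: "compatible_triple I J K \<alpha> \<beta> \<gamma>" for I J K \<alpha> \<beta> \<gamma>
  proof -
    have f: "\<alpha> \<in> two_forms" "\<beta> \<in> two_forms" "\<gamma> \<in> two_forms"
      using ct unfolding compatible_triple_def by auto
    have "triple_generator I J K \<alpha> \<beta> \<gamma> y (I z) = - \<alpha> y z - \<beta> y (K z) + \<gamma> y (J z)"
      by (simp add: triple_generator_def adapted_basis_mult[OF ab] adapted_basisD(1)[OF ab]
          two_formsD[OF f(1)] two_formsD[OF f(2)])
    moreover have "triple_generator I J K \<alpha> \<beta> \<gamma> (I y) z = - \<alpha> y z - \<beta> (K y) z + \<gamma> (J y) z"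
      by (simp add: triple_generator_left[OF ab ct] adapted_basis_mult[OF ab]
          adapted_basisD(1)[OF ab] two_formsD[OF f(1)] two_formsD[OF f(2)])
    ultimately show ?thesis
      using compatible_triple_first[OF ab ct, of y z] by (simp add: i_op_apply)
  qed
  note ab' = adapted_basis_rotate[OF ab] and ct' = compatible_triple_rotate[OF ct]
  show "i_op I (triple_generator I J K \<alpha> \<beta> \<gamma>) y z = 4 * \<alpha> y z"
    by (rule *[OF ab ct])
  show "i_op J (triple_generator I J K \<alpha> \<beta> \<gamma>) y z = 4 * \<beta> y z"
    using *[OF ab' ct'] by (simp add: triple_generator_rotate)
  show "i_op K (triple_generator I J K \<alpha> \<beta> \<gamma>) y z = 4 * \<gamma> y z"
    using *[OF adapted_basis_rotate[OF ab'] compatible_triple_rotate[OF ct']]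
    by (simp add: triple_generator_rotate)
qed

text \<open>
  This is the equation for orthogonality to \<open>sp(n)\<close>. As \<open>i\<^sub>A \<delta>(y, A z) = \<delta>(y, z) - \<delta>(A y, A z)\<close>,
  the previous lemma evaluates each difference, and the three of them add up to four times the
  definition of \<open>\<delta>\<close>.
\<close>

lemma triple_generator_sum_eq_0:
  assumes ab: "adapted_basis G I J K" and ct: "compatible_triple I J K \<alpha> \<beta> \<gamma>"
  defines "\<delta> \<equiv> triple_generator I J K \<alpha> \<beta> \<gamma>"
  shows "\<delta> y z + \<delta> (I y) (I z) + \<delta> (J y) (J z) + \<delta> (K y) (K z) = 0"
proof -
  have f: "\<delta> \<in> two_forms" unfolding \<delta>_def by (rule triple_generator_two_forms[OF ab ct])
  have e: "\<delta> y z - \<delta> (A y) (A z) = i_op A \<delta> y (A z)" if "A \<in> {I, J, K}" for A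
    by (simp add: i_op_apply adapted_basisD(1)[OF ab that] two_formsD[OF f])
  have "\<delta> y z - \<delta> (I y) (I z) = 4 * \<alpha> y (I z)" "\<delta> y z - \<delta> (J y) (J z) = 4 * \<beta> y (J z)"
    "\<delta> y z - \<delta> (K y) (K z) = 4 * \<gamma> y (K z)"
    using e[of I] e[of J] e[of K] i_op_triple_generator[OF ab ct] by (simp_all add: \<delta>_def)
  moreover have "\<delta> y z = \<alpha> y (I z) + \<beta> y (J z) + \<gamma> y (K z)"
    by (simp add: \<delta>_def triple_generator_def)
  ultimately show ?thesis by simp
qed

section \<open>Traces against the fundamental two-forms\<close>

lemma sum_Basis_bilinear_inner:
  fixes \<alpha> :: "'a::euclidean_space \<Rightarrow> 'a \<Rightarrow> real"
  assumes "\<alpha> \<in> two_forms"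
  shows "(\<Sum>i\<in>Basis. \<alpha> i y * (i \<bullet> z)) = \<alpha> z y"
proof -
  have l: "linear (\<lambda>x. \<alpha> x y)" using two_formsD(1)[OF assms] by (simp add: bilinear_def)
  show ?thesis
    using linear_sum[OF l, of "\<lambda>i. (z \<bullet> i) *\<^sub>R i" Basis]
    by (simp add: euclidean_representation linear_cmul[OF l] inner_commute[of _ z] mult.commute)
qed

lemma form_inner_omega:
  assumes "\<alpha> \<in> two_forms"
  shows "form_inner \<alpha> (omega B) = (\<Sum>i\<in>Basis. \<alpha> (B i) i) / 2"
proof -
  have "\<alpha> (B j) j = (\<Sum>i\<in>Basis. \<alpha> i j * (i \<bullet> B j))" for j
    by (simp add: sum_Basis_bilinear_inner[OF assms])
  moreover have "(\<Sum>i\<in>Basis. \<Sum>j\<in>Basis. \<alpha> i j * (i \<bullet> B j))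
      = (\<Sum>j\<in>Basis. \<Sum>i\<in>Basis. \<alpha> i j * (i \<bullet> B j))" by (rule sum.swap)
  ultimately show ?thesis by (simp add: form_inner_def omega_def)
qed

lemma form_inner_omega_omega:
  assumes ab: "adapted_basis G I J K" and A: "A \<in> {I, J, K}" and B: "B \<in> {I, J, K}"
  shows "form_inner (omega A) (omega B :: 'a::euclidean_space \<Rightarrow> 'a \<Rightarrow> real)
    = (if A = B then DIM('a) / 2 else 0)"
proof -
  have z: "x \<bullet> C x = 0" if "C \<in> {I, J, K}" for C x
    using adapted_basisD(3)[OF ab that, of x x] by (simp add: inner_commute)
  have "B i \<bullet> A i = (if A = B then 1 else 0)" if "i \<in> Basis" for i
  proof (cases "A = B")
    case True
    thus ?thesis using that adapted_basisD(2)[OF ab A, of i i] by simp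
  next
    case False
    have "B i \<bullet> A i = - (i \<bullet> B (A i))" by (rule adapted_basisD(3)[OF ab B])
    also have "\<dots> = 0" using A B False z[of I i] z[of J i] z[of K i]
      by (auto simp: adapted_basis_mult[OF ab])
    finally show ?thesis using False by simp
  qed
  thus ?thesis
    by (simp add: form_inner_omega[OF omega_two_forms[OF ab A]] omega_def)
qed

text \<open>
  Moving \<open>i\<^sub>A\<close> to the other side of the inner product turns \<open>\<omega>\<^sub>B\<close> into the two-form of the commutator
  of \<open>A\<close> and \<open>B\<close>, which is zero or twice an element of \<open>{I, J, K}\<close> up to sign.
\<close>

lemma form_inner_i_op_omega:
  assumes ab: "adapted_basis G I J K" and A: "A \<in> {I, J, K}" and B: "B \<in> {I, J, K}"
    and f: "\<beta> \<in> two_forms" and o: "\<And>C. C \<in> {I, J, K} \<Longrightarrow> form_inner \<beta> (omega C) = 0"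
  shows "form_inner (i_op A \<beta>) (omega B) = 0"
proof -
  have z: "(\<Sum>i\<in>Basis. \<beta> (C i) i) = 0" if "C \<in> {I, J, K}" for C
    using o[OF that] form_inner_omega[OF f, of C] by simp
  have d: "(\<Sum>i\<in>Basis. \<beta> i i) = 0" using f by (simp add: two_forms_def)
  have "(\<Sum>i\<in>Basis. \<beta> (B i) (A i)) = - (\<Sum>i\<in>Basis. \<beta> (B (A i)) i)"
  proof -
    have "bilinear (\<lambda>x y. \<beta> (B x) y)"
      by (simp add: bilinear_def linear_iff two_formsD[OF f] blinfun.add_right blinfun.scaleR_right)
    from sum_Basis_skew[OF this adapted_basisD(3)[OF ab A]] show ?thesis by simp
  qed
  hence "form_inner (i_op A \<beta>) (omega B)
      = ((\<Sum>i\<in>Basis. \<beta> (B (A i)) i) - (\<Sum>i\<in>Basis. \<beta> (A (B i)) i)) / 2"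
    by (simp add: form_inner_omega[OF i_op_two_forms[OF f]] i_op_apply sum_subtractf sum_negf)
  also have "\<dots> = 0" using A B z[of I] z[of J] z[of K] d
    by (auto simp: adapted_basis_mult[OF ab] adapted_basisD(1)[OF ab] two_formsD[OF f] sum_negf)
  finally show ?thesis .
qed

section \<open>Contraction of four-forms and uniqueness\<close>

text \<open>
  Of the six terms of the wedge product, the first carries the trace of \<open>\<alpha>\<close> against \<open>\<omega>\<^sub>B\<close> and
  vanishes, the last is \<open>\<alpha>\<close> times the trace of \<open>A B\<close>, and the four mixed ones insert \<open>B A\<close> into one argument of \<open>\<alpha>\<close>.
\<close>

lemma contraction_wedge_omega:
  fixes \<alpha> :: "'a::euclidean_space \<Rightarrow> 'a \<Rightarrow> real"
  assumes ab: "adapted_basis G I J K" and A: "A \<in> {I, J, K}" and B: "B \<in> {I, J, K}"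
    and f: "\<alpha> \<in> two_forms" and o: "form_inner \<alpha> (omega B) = 0"
  shows "(\<Sum>i\<in>Basis. wedge \<alpha> (omega A) i (B i) y z)
    = - 2 * (\<alpha> (B (A y)) z + \<alpha> y (B (A z))) - (if A = B then real DIM('a) else 0) * \<alpha> y z"
proof -
  note sk = adapted_basisD(3)[OF ab B]
  have t: "(\<Sum>i\<in>Basis. \<alpha> i (B i)) = 0"
    using o sum_Basis_skew[OF two_formsD(1)[OF f] sk] by (simp add: form_inner_omega[OF f])
  have s1: "(\<Sum>i\<in>Basis. \<alpha> i v * omega A (B i) w) = - \<alpha> (B (A w)) v" for v w
    using sum_Basis_bilinear_inner[OF f, of v "B (A w)"]
    by (simp add: omega_def sk sum_negf)
  have s2: "(\<Sum>i\<in>Basis. \<alpha> (B i) v * omega A i w) = \<alpha> (B (A w)) v" for v w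
  proof -
    have "bilinear (\<lambda>x y. \<alpha> x v * (y \<bullet> A w))"
      by (simp add: bilinear_def linear_iff two_formsD[OF f] inner_add_left algebra_simps)
    from sum_Basis_skew[OF this sk] s1[of v w] show ?thesis by (simp add: omega_def)
  qed
  have s3: "(\<Sum>i\<in>Basis. omega A i (B i)) = - (if A = B then real DIM('a) else 0)"
  proof -
    have fa: "omega A \<in> two_forms" by (rule omega_two_forms[OF ab A])
    show ?thesis
      using form_inner_omega_omega[OF ab A B] sum_Basis_skew[OF two_formsD(1)[OF fa] sk]
      by (simp add: form_inner_omega[OF fa] split: if_splits)
  qed
  have "(\<Sum>i\<in>Basis. wedge \<alpha> (omega A) i (B i) y z)
      = (\<Sum>i\<in>Basis. \<alpha> i (B i)) * omega A y z - (\<Sum>i\<in>Basis. \<alpha> i y * omega A (B i) z)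
        + (\<Sum>i\<in>Basis. \<alpha> i z * omega A (B i) y) + (\<Sum>i\<in>Basis. \<alpha> (B i) y * omega A i z)
        - (\<Sum>i\<in>Basis. \<alpha> (B i) z * omega A i y) + \<alpha> y z * (\<Sum>i\<in>Basis. omega A i (B i))"
    by (simp add: wedge_def sum.distrib sum_subtractf sum_distrib_left sum_distrib_right)
  also have "\<dots> = 2 * \<alpha> (B (A z)) y - 2 * \<alpha> (B (A y)) z
      - (if A = B then real DIM('a) else 0) * \<alpha> y z"
    by (simp add: t s1 s2 s3)
  finally show ?thesis using two_forms_skew[OF f, of "B (A z)" y] by simp
qed

text \<open>
  The contraction is applied with \<open>B A\<close> equal to \<open>-1\<close>, \<open>K\<close> and \<open>- J\<close> for the three terms. The
  resulting contributions of \<open>\<beta>\<close> and \<open>\<gamma>\<close> add up to a multiple of \<open>\<alpha>\<close> by \<open>compatible_triple_first\<close>, and cancel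
  the excess \<open>4 \<alpha>\<close> of the first term.
\<close>

lemma contraction_compatible_triple:
  fixes \<alpha> \<beta> \<gamma> :: "'a::euclidean_space \<Rightarrow> 'a \<Rightarrow> real"
  assumes ab: "adapted_basis G I J K" and ct: "compatible_triple I J K \<alpha> \<beta> \<gamma>"
    and o: "\<And>\<delta>. \<delta> \<in> {\<alpha>, \<beta>, \<gamma>} \<Longrightarrow> form_inner \<delta> (omega I) = 0"
  shows "(\<Sum>i\<in>Basis. wedge \<alpha> (omega I) i (I i) y z + wedge \<beta> (omega J) i (I i) y z
      + wedge \<gamma> (omega K) i (I i) y z) = - real DIM('a) * \<alpha> y z"
proof -
  have d: "J \<noteq> I" "K \<noteq> I" using ab unfolding adapted_basis_def by auto
  have f: "\<alpha> \<in> two_forms" "\<beta> \<in> two_forms" "\<gamma> \<in> two_forms"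
    using ct unfolding compatible_triple_def by auto
  show ?thesis
    using compatible_triple_first[OF ab ct, of y z] d
    by (simp add: sum.distrib contraction_wedge_omega[OF ab] f o adapted_basis_mult[OF ab]
        adapted_basisD(1)[OF ab] two_formsD[OF f(1)] two_formsD[OF f(2)] two_formsD[OF f(3)]
        algebra_simps)
qed

lemma compatible_triple_unique:
  fixes \<alpha> \<beta> \<gamma> :: "'a::euclidean_space \<Rightarrow> 'a \<Rightarrow> real"
  assumes ab: "adapted_basis G I J K"
    and ct: "compatible_triple I J K \<alpha> \<beta> \<gamma>" "compatible_triple I J K \<alpha>' \<beta>' \<gamma>'"
    and o: "\<And>\<delta> B. \<delta> \<in> {\<alpha>, \<beta>, \<gamma>, \<alpha>', \<beta>', \<gamma>'} \<Longrightarrow> B \<in> {I, J, K} \<Longrightarrow> form_inner \<delta> (omega B) = 0"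
    and eq: "wedge \<alpha> (omega I) + wedge \<beta> (omega J) + wedge \<gamma> (omega K)
      = wedge \<alpha>' (omega I) + wedge \<beta>' (omega J) + wedge \<gamma>' (omega K)"
  shows "\<alpha> = \<alpha>'" "\<beta> = \<beta>'" "\<gamma> = \<gamma>'"
proof -
  have *: "\<alpha> = \<alpha>'"
    if ab: "adapted_basis G I J K"
      and ct: "compatible_triple I J K \<alpha> \<beta> \<gamma>" "compatible_triple I J K \<alpha>' \<beta>' \<gamma>'"
      and o: "\<And>\<delta>. \<delta> \<in> {\<alpha>, \<beta>, \<gamma>, \<alpha>', \<beta>', \<gamma>'} \<Longrightarrow> form_inner \<delta> (omega I) = 0"
      and eq: "wedge \<alpha> (omega I) + wedge \<beta> (omega J) + wedge \<gamma> (omega K)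
        = wedge \<alpha>' (omega I) + wedge \<beta>' (omega J) + wedge \<gamma>' (omega K)"
    for I J K and \<alpha> \<beta> \<gamma> \<alpha>' \<beta>' \<gamma>' :: "'a \<Rightarrow> 'a \<Rightarrow> real"
  proof (intro ext)
    fix y z
    have "wedge \<alpha> (omega I) i (I i) y z + wedge \<beta> (omega J) i (I i) y z
        + wedge \<gamma> (omega K) i (I i) y z
      = wedge \<alpha>' (omega I) i (I i) y z + wedge \<beta>' (omega J) i (I i) y z
        + wedge \<gamma>' (omega K) i (I i) y z" for i
      using fun_cong[OF fun_cong[OF fun_cong[OF fun_cong[OF eq, of i], of "I i"], of y], of z]
      by simp
    moreover have "form_inner \<delta> (omega I) = 0" if "\<delta> \<in> {\<alpha>, \<beta>, \<gamma>} \<or> \<delta> \<in> {\<alpha>', \<beta>', \<gamma>'}" for \<delta>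
      using that by (intro o) auto
    ultimately have "- real DIM('a) * \<alpha> y z = - real DIM('a) * \<alpha>' y z"
      by (simp only: contraction_compatible_triple[OF ab ct(1), symmetric]
          contraction_compatible_triple[OF ab ct(2), symmetric] simp_thms)
    thus "\<alpha> y z = \<alpha>' y z" by simp
  qed
  note ab' = adapted_basis_rotate[OF ab] and ct' = ct[THEN compatible_triple_rotate]
  note ab'' = adapted_basis_rotate[OF ab'] and ct'' = ct'[THEN compatible_triple_rotate]
  show "\<alpha> = \<alpha>'" by (rule *[OF ab ct]) (use o eq in auto)
  show "\<beta> = \<beta>'" by (rule *[OF ab' ct']) (use o eq in \<open>auto simp: add_ac\<close>)
  show "\<gamma> = \<gamma>'" by (rule *[OF ab'' ct'']) (use o eq in \<open>auto simp: add_ac\<close>)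
qed

section \<open>Removing the trace\<close>

text \<open>
  For \<open>B \<noteq> A\<close> the form \<open>i\<^sub>B \<omega>\<^sub>A\<close> is \<open>2 \<omega>\<^sub>C\<close> up to sign, where \<open>C\<close> is the third structure. What remains
  is \<open>\<omega>\<^sub>C \<and> \<omega>\<^sub>B\<close> and \<open>\<omega>\<^sub>B \<and> \<omega>\<^sub>C\<close> with opposite signs, and two-forms commute.
\<close>

lemma embed_four_omega:
  assumes ab: "adapted_basis G I J K" and A: "A \<in> {I, J, K}"
  shows "embed_four I J K (omega A) = 0"
proof -
  have i: "i_op B (omega A) x y = x \<bullet> B (A y) - x \<bullet> A (B y)" if "B \<in> {I, J, K}" for B x y
    by (simp add: i_op_apply omega_def adapted_basisD(3)[OF ab that])
  show ?thesis
    unfolding embed_four_def fun_eq_iff wedge_def using A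
    by (auto simp: i adapted_basis_mult[OF ab] omega_def algebra_simps)
qed

lemma embed_four_diff_scaled:
  "embed_four I J K (\<lambda>y z. \<alpha> y z - r * \<beta> y z)
    = (\<lambda>x y z w. embed_four I J K \<alpha> x y z w - r * embed_four I J K \<beta> x y z w)"
  by (simp add: embed_four_def wedge_def i_op_apply fun_eq_iff algebra_simps)

lemma embed_four_eq_wedge_sum:
  "embed_four I J K \<beta> = wedge (\<lambda>y z. i_op I \<beta> y z / 4) (omega I)
    + wedge (\<lambda>y z. i_op J \<beta> y z / 4) (omega J) + wedge (\<lambda>y z. i_op K \<beta> y z / 4) (omega K)"
  by (simp add: embed_four_def wedge_def fun_eq_iff algebra_simps)

text \<open>
  The \<open>\<omega>\<^sub>A\<close> are orthogonal to each other, of squared norm \<open>dim V / 2\<close>, so \<open>t\<close> gives the coefficients of the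
  orthogonal projection onto their span. Subtracting it respects the equation for orthogonality to
  \<open>sp(n)\<close>, because \<open>\<omega>\<^sub>A\<close> is invariant under two of the four terms and changes sign under the other two.
\<close>

lemma trace_free_L02E_S2H:
  fixes G :: "('a::euclidean_space \<Rightarrow>\<^sub>L 'a) set"
  assumes ab: "adapted_basis G I J K" and f: "\<delta> \<in> two_forms"
    and s: "\<And>y z. \<delta> y z + \<delta> (I y) (I z) + \<delta> (J y) (J z) + \<delta> (K y) (K z) = 0"
  defines "t \<equiv> \<lambda>B. 2 / real DIM('a) * form_inner \<delta> (omega B)"
  shows "(\<lambda>y z. \<delta> y z - t I * omega I y z - t J * omega J y z - t K * omega K y z) \<in> L02E_S2H G"
    (is "?\<delta> \<in> _")
proof -
  have d: "I \<noteq> J" "I \<noteq> K" "J \<noteq> K" using ab unfolding adapted_basis_def by auto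
  have tf: "?\<delta> \<in> two_forms"
  proof (rule two_formsI)
    show "?\<delta> x y = - ?\<delta> y x" for x y
      using two_forms_skew[OF f, of x y] two_forms_skew[OF omega_two_forms[OF ab], of _ x y]
      by simp
  qed (simp_all add: two_formsD[OF f] two_formsD[OF omega_two_forms[OF ab]] algebra_simps)
  have w: "omega A (B y) (B z) = (if A = B then 1 else -1) * omega A y z"
    if A: "A \<in> {I, J, K}" and B: "B \<in> {I, J, K}" for A B y z
    using A B d by (auto simp: omega_def adapted_basisD[OF ab] adapted_basis_mult[OF ab]
        blinfun.minus_right)
  have "?\<delta> + (slot1 I (slot2 I ?\<delta>) + slot1 J (slot2 J ?\<delta>) + slot1 K (slot2 K ?\<delta>)) = 0"
  proof (intro ext)
    fix y z
    show "(?\<delta> + (slot1 I (slot2 I ?\<delta>) + slot1 J (slot2 J ?\<delta>) + slot1 K (slot2 K ?\<delta>))) y z = 0 y z"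
      using s[of y z] d by (simp add: slot1_def slot2_def w)
  qed
  moreover have "form_inner ?\<delta> (omega B) = 0" if B: "B \<in> {I, J, K}" for B
  proof -
    have "form_inner ?\<delta> (omega B) = form_inner \<delta> (omega B) - t I * form_inner (omega I) (omega B)
      - t J * form_inner (omega J) (omega B) - t K * form_inner (omega K) (omega B)"
      by (simp add: form_inner_def algebra_simps sum_subtractf sum_distrib_left sum.distrib
          add_divide_distrib diff_divide_distrib)
    also have "\<dots> = 0"
      using B d by (auto simp: form_inner_omega_omega[OF ab] t_def)
    finally show ?thesis .
  qed
  ultimately show ?thesis using L02E_S2H_iff[OF ab tf] by blast
qed

lemma linear_form_inner:
  assumes "c \<in> V_two_forms"
  shows "linear (\<lambda>x. form_inner (c x) \<beta>)"
  using assms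
  by (simp add: V_two_forms_def linear_iff form_inner_def algebra_simps sum.distrib
      sum_distrib_left add_divide_distrib)

section \<open>The equivalence\<close>

text \<open>
  The generator of the triple has the right image under \<open>embed_four\<close> but possibly a component along
  the \<open>\<omega>\<^sub>A\<close>. Removing this component does not change the image.
\<close>

lemma compatible_triples_imp_V_L02E_S2H:
  fixes G :: "('a::euclidean_space \<Rightarrow>\<^sub>L 'a) set"
  assumes ab: "adapted_basis G I J K"
    and V: "dI \<in> V_two_forms" "dJ \<in> V_two_forms" "dK \<in> V_two_forms"
    and ct: "\<And>x. compatible_triple I J K (dI x) (dJ x) (dK x)"
    and a: "a = wedge_snd dI (omega I) + wedge_snd dJ (omega J) + wedge_snd dK (omega K)"
  shows "a \<in> V_L02E_S2H G"
proof -
  define \<delta> where "\<delta> x = triple_generator I J K (dI x) (dJ x) (dK x)" for x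
  define t where "t B x = 2 / real DIM('a) * form_inner (\<delta> x) (omega B)" for B x
  define c where "c x y z = \<delta> x y z - t I x * omega I y z - t J x * omega J y z
    - t K x * omega K y z" for x y z
  have f: "\<delta> x \<in> two_forms" for x
    unfolding \<delta>_def by (rule triple_generator_two_forms[OF ab ct])
  have V\<delta>: "\<delta> \<in> V_two_forms"
    using V f by (simp add: V_two_forms_def linear_iff \<delta>_def triple_generator_def algebra_simps)
  have L: "c x \<in> L02E_S2H G" for x
    unfolding c_def t_def
    by (rule trace_free_L02E_S2H[OF ab f])
      (unfold \<delta>_def, rule triple_generator_sum_eq_0[OF ab ct])
  have "linear (\<lambda>x. c x y z)" for y z
  proof -
    have "linear (\<lambda>x. \<delta> x y z)" using V\<delta> by (simp add: V_two_forms_def)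
    thus ?thesis
      using linear_form_inner[OF V\<delta>] by (simp add: c_def t_def linear_iff algebra_simps add_divide_distrib)
  qed
  hence "c \<in> V_two_forms" using L by (simp add: V_two_forms_def L02E_S2H_def)
  moreover have "a = (\<lambda>x. embed_four I J K (c x))"
  proof
    fix x
    have "embed_four I J K (c x) = embed_four I J K (\<delta> x)"
      unfolding c_def by (simp add: embed_four_diff_scaled embed_four_omega[OF ab])
    also have "\<dots> = a x"
      unfolding embed_four_eq_wedge_sum a
      by (simp add: \<delta>_def i_op_triple_generator[OF ab ct] wedge_snd_def)
    finally show "a x = embed_four I J K (c x)" by simp
  qed
  ultimately show ?thesis unfolding V_L02E_S2H_def using ab L by blast
qed

text \<open>
  The signs in the operators \<open>A\<^bsub>(2)\<^esub>\<close> and \<open>A\<^bsub>(3)\<^esub>\<close> cancel in pairs, so the tensor equations are the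
  compatibility conditions for every value of the first argument.
\<close>

lemma compatible_triple_iff_slots:
  assumes "cI \<in> V_two_forms" "cJ \<in> V_two_forms" "cK \<in> V_two_forms"
  shows "(\<forall>x. compatible_triple I J K (cI x) (cJ x) (cK x)) \<longleftrightarrow>
    slot2 I (slot3 I cI) = - cI \<and> slot2 J (slot3 J cJ) = - cJ \<and> slot2 K (slot3 K cK) = - cK \<and>
    slot2 I (slot3 J cK) + slot2 J (slot3 K cI) + slot2 K (slot3 I cJ) = 0"
  using assms
  by (auto simp: compatible_triple_def V_two_forms_def slot2_def slot3_def fun_eq_iff)

text \<open>
  The witnesses are \<open>i\<^sub>A c / 4\<close> for the adapted basis and the tensor \<open>c\<close> of a representation of \<open>a\<close>;
  orthogonality to the \<open>\<omega>\<^sub>B\<close> passes from \<open>c\<close> to them.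
\<close>

lemma V_L02E_S2H_imp_compatible_triples:
  fixes G :: "('a::euclidean_space \<Rightarrow>\<^sub>L 'a) set"
  assumes "a \<in> V_L02E_S2H G"
  obtains I J K cI cJ cK where "adapted_basis G I J K"
    "cI \<in> V_two_forms" "cJ \<in> V_two_forms" "cK \<in> V_two_forms"
    "\<And>x. compatible_triple I J K (cI x) (cJ x) (cK x)"
    "\<And>x c B. c \<in> {cI, cJ, cK} \<Longrightarrow> B \<in> {I, J, K} \<Longrightarrow> form_inner (c x) (omega B) = 0"
    "a = wedge_snd cI (omega I) + wedge_snd cJ (omega J) + wedge_snd cK (omega K)"
proof -
  from assms obtain I J K c where ab: "adapted_basis G I J K" and c: "c \<in> V_two_forms"
    and L: "\<And>x. c x \<in> L02E_S2H G" and a: "a = (\<lambda>x. embed_four I J K (c x))"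
    unfolding V_L02E_S2H_def by blast
  have f: "c x \<in> two_forms" for x using c by (simp add: V_two_forms_def)
  define e where "e A x y z = i_op A (c x) y z / 4" for A x y z
  have ct: "compatible_triple I J K (e I x) (e J x) (e K x)" for x
    unfolding e_def by (rule i_op_compatible_triple[OF ab f])
  have V: "e A \<in> V_two_forms" if "A \<in> {I, J, K}" for A
  proof -
    have "linear (\<lambda>x. e A x y z)" for y z
      using c by (simp add: V_two_forms_def linear_iff e_def i_op_apply algebra_simps
          add_divide_distrib diff_divide_distrib)
    thus ?thesis using ct that by (auto simp: V_two_forms_def compatible_triple_def)
  qed
  have o: "form_inner (e A x) (omega B) = 0" if "A \<in> {I, J, K}" "B \<in> {I, J, K}" for A B x
  proof -
    have "form_inner (c x) (omega C) = 0" if "C \<in> {I, J, K}" for C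
      using L[of x] that L02E_S2H_iff[OF ab f] by blast
    hence "form_inner (i_op A (c x)) (omega B) = 0"
      by (rule form_inner_i_op_omega[OF ab that f])
    moreover have "form_inner (e A x) (omega B) = form_inner (i_op A (c x)) (omega B) / 4"
      by (simp add: form_inner_def e_def sum_divide_distrib)
    ultimately show ?thesis by simp
  qed
  have "a = wedge_snd (e I) (omega I) + wedge_snd (e J) (omega J) + wedge_snd (e K) (omega K)"
    by (simp add: a fun_eq_iff embed_four_def wedge_snd_def wedge_def e_def algebra_simps)
  then show ?thesis
    using that[OF ab V V V ct] o by blast
qed

theorem proposition3p1:
  fixes G :: "('a::euclidean_space \<Rightarrow>\<^sub>L 'a) set" and n :: nat
    and a :: "'a \<Rightarrow> 'a \<Rightarrow> 'a \<Rightarrow> 'a \<Rightarrow> 'a \<Rightarrow> real"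
  assumes "DIM('a) = 4 * n" and "n > 1"
    and "subspace G" and "dim G = 3" and "\<exists>I J K. adapted_basis G I J K"
    and "a \<in> V_four_forms"
  shows
    "(a \<in> V_L02E_S2H G \<longleftrightarrow>
      (\<exists>I J K. adapted_basis G I J K \<and>
        (\<exists>!(cI, cJ, cK) \<in> V_two_forms \<times> V_two_forms \<times> V_two_forms.
          a = wedge_snd cI (omega I) + wedge_snd cJ (omega J) + wedge_snd cK (omega K) \<and>
          slot2 I (slot3 I cI) = - cI \<and> slot2 J (slot3 J cJ) = - cJ \<and> slot2 K (slot3 K cK) = - cK \<and>
          slot2 I (slot3 J cK) + slot2 J (slot3 K cI) + slot2 K (slot3 I cJ) = 0 \<and>
          (\<forall>x. \<forall>c\<in>{cI, cJ, cK}. \<forall>B\<in>{I, J, K}. form_inner (c x) (omega B) = 0))))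
    \<and> (a \<in> V_L02E_S2H G \<longleftrightarrow>
      (\<exists>I J K. adapted_basis G I J K \<and>
        (\<exists>dI\<in>V_two_forms. \<exists>dJ\<in>V_two_forms. \<exists>dK\<in>V_two_forms.
          a = wedge_snd dI (omega I) + wedge_snd dJ (omega J) + wedge_snd dK (omega K) \<and>
          slot2 I (slot3 I dI) = - dI \<and> slot2 J (slot3 J dJ) = - dJ \<and> slot2 K (slot3 K dK) = - dK \<and>
          slot2 I (slot3 J dK) + slot2 J (slot3 K dI) + slot2 K (slot3 I dJ) = 0)))"
proof -
  have unique: "\<exists>I J K. adapted_basis G I J K \<and>
        (\<exists>!(cI, cJ, cK) \<in> V_two_forms \<times> V_two_forms \<times> V_two_forms.
          a = wedge_snd cI (omega I) + wedge_snd cJ (omega J) + wedge_snd cK (omega K) \<and>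
          slot2 I (slot3 I cI) = - cI \<and> slot2 J (slot3 J cJ) = - cJ \<and> slot2 K (slot3 K cK) = - cK \<and>
          slot2 I (slot3 J cK) + slot2 J (slot3 K cI) + slot2 K (slot3 I cJ) = 0 \<and>
          (\<forall>x. \<forall>c\<in>{cI, cJ, cK}. \<forall>B\<in>{I, J, K}. form_inner (c x) (omega B) = 0))"
    if member: "a \<in> V_L02E_S2H G"
  proof -
    obtain I J K cI cJ cK where ab: "adapted_basis G I J K"
      and V: "cI \<in> V_two_forms" "cJ \<in> V_two_forms" "cK \<in> V_two_forms"
      and ct: "\<And>x. compatible_triple I J K (cI x) (cJ x) (cK x)"
      and o: "\<And>x c B. c \<in> {cI, cJ, cK} \<Longrightarrow> B \<in> {I, J, K} \<Longrightarrow> form_inner (c x) (omega B) = 0"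
      and a: "a = wedge_snd cI (omega I) + wedge_snd cJ (omega J) + wedge_snd cK (omega K)"
      by (rule V_L02E_S2H_imp_compatible_triples[OF member]) (rule that)
    let ?P = "\<lambda>(cI, cJ, cK). (cI, cJ, cK) \<in> V_two_forms \<times> V_two_forms \<times> V_two_forms \<and>
          a = wedge_snd cI (omega I) + wedge_snd cJ (omega J) + wedge_snd cK (omega K) \<and>
          slot2 I (slot3 I cI) = - cI \<and> slot2 J (slot3 J cJ) = - cJ \<and> slot2 K (slot3 K cK) = - cK \<and>
          slot2 I (slot3 J cK) + slot2 J (slot3 K cI) + slot2 K (slot3 I cJ) = 0 \<and>
          (\<forall>x. \<forall>c\<in>{cI, cJ, cK}. \<forall>B\<in>{I, J, K}. form_inner (c x) (omega B) = 0)"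
    have slots: "slot2 I (slot3 I cI) = - cI \<and> slot2 J (slot3 J cJ) = - cJ \<and> slot2 K (slot3 K cK) = - cK \<and>
          slot2 I (slot3 J cK) + slot2 J (slot3 K cI) + slot2 K (slot3 I cJ) = 0"
      unfolding compatible_triple_iff_slots[OF V, symmetric] using ct by (rule allI)
    have "\<exists>!p. ?P p"
    proof (rule ex1I[of _ "(cI, cJ, cK)"])
      show "?P (cI, cJ, cK)"
        unfolding prod.case
      proof (intro conjI allI ballI)
        show "(cI, cJ, cK) \<in> V_two_forms \<times> V_two_forms \<times> V_two_forms" using V by blast
        show "form_inner (c x) (omega B) = 0" if "c \<in> {cI, cJ, cK}" "B \<in> {I, J, K}" for x c B
          by (rule o[OF that])
      qed (rule a, (use slots in blast)+)
    next
      fix p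
      assume p: "?P p"
      obtain dI dJ dK where pd: "p = (dI, dJ, dK)" by (cases p) auto
      note P = p[unfolded pd prod.case]
      have W: "dI \<in> V_two_forms" "dJ \<in> V_two_forms" "dK \<in> V_two_forms" using P by blast+
      have ct': "compatible_triple I J K (dI x) (dJ x) (dK x)" for x
      proof -
        have "slot2 I (slot3 I dI) = - dI \<and> slot2 J (slot3 J dJ) = - dJ \<and>
            slot2 K (slot3 K dK) = - dK \<and>
            slot2 I (slot3 J dK) + slot2 J (slot3 K dI) + slot2 K (slot3 I dJ) = 0"
          using P by blast
        from this[folded compatible_triple_iff_slots[OF W]] show ?thesis by (rule spec)
      qed
      have o': "form_inner \<delta> (omega B) = 0"
        if "\<delta> \<in> {dI x, dJ x, dK x, cI x, cJ x, cK x}" "B \<in> {I, J, K}" for \<delta> B x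
      proof -
        have "form_inner (d x) (omega B) = 0" if "d \<in> {dI, dJ, dK}" for d
          using P that \<open>B \<in> {I, J, K}\<close> by blast
        thus ?thesis using that o[of _ B x] by auto
      qed
      have eq: "wedge (dI x) (omega I) + wedge (dJ x) (omega J) + wedge (dK x) (omega K)
          = wedge (cI x) (omega I) + wedge (cJ x) (omega J) + wedge (cK x) (omega K)" for x
      proof -
        have "a x = wedge (dI x) (omega I) + wedge (dJ x) (omega J) + wedge (dK x) (omega K)"
          by (subst conjunct1[OF conjunct2[OF P]]) (simp add: wedge_snd_def)
        moreover have "a x = wedge (cI x) (omega I) + wedge (cJ x) (omega J) + wedge (cK x) (omega K)"
          by (subst a) (simp add: wedge_snd_def)
        ultimately show ?thesis by simp
      qed
      have "dI x = cI x" "dJ x = cJ x" "dK x = cK x" for x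
        by (rule compatible_triple_unique[OF ab ct'[of x] ct[of x] _ eq[of x]], rule o', assumption+)+
      hence "dI = cI" "dJ = cJ" "dK = cK" by blast+
      thus "p = (cI, cJ, cK)" by (simp add: pd)
    qed
    thus ?thesis by (intro exI conjI) (rule ab)
  qed
  have converse: "a \<in> V_L02E_S2H G"
    if ab: "adapted_basis G I J K"
      and V: "dI \<in> V_two_forms" "dJ \<in> V_two_forms" "dK \<in> V_two_forms"
      and a: "a = wedge_snd dI (omega I) + wedge_snd dJ (omega J) + wedge_snd dK (omega K)"
      and s: "slot2 I (slot3 I dI) = - dI" "slot2 J (slot3 J dJ) = - dJ" "slot2 K (slot3 K dK) = - dK"
        "slot2 I (slot3 J dK) + slot2 J (slot3 K dI) + slot2 K (slot3 I dJ) = 0"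
    for I J K dI dJ dK
  proof -
    have "\<forall>x. compatible_triple I J K (dI x) (dJ x) (dK x)"
      using s by (simp only: compatible_triple_iff_slots[OF V])
    thus ?thesis using compatible_triples_imp_V_L02E_S2H[OF ab V _ a] by simp
  qed
  show ?thesis
  proof (intro conjI iffI, goal_cases)
    case 1
    thus ?case by (rule unique)
  next
    case 2
    thus ?case by (elim exE conjE ex1E case_prodE SigmaE2) (rule converse, assumption+)
  next
    case 3
    from unique[OF 3] show ?case
      by (elim exE conjE ex1E case_prodE SigmaE2) (intro exI conjI bexI, assumption+)
  next
    case 4
    thus ?case by (elim exE conjE bexE) (rule converse)
  qed
qed

end
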